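(* Let $d\ge 1$, let $w^k\in\mathbb{R}^d$ be the (public) global model parameters at step $k$, let $U=\mathbb{R}^d$ and $V=\{-1,1\}^d$, and let $F^P:U\to V$ be the update-preprocessing function of robust stochastic aggregation (RSA), $F^P(u)=\mathrm{sign}(w^k-u)$, with $\mathrm{sign}$ applied coordinatewise. Then $F^P$ is a computationally surjective function.
   Context: A function $f:U\to V$ is computationally surjective if there is a probabilistic polynomial-time algorithm $\mathcal{A}:V\to U$ such that $f(\mathcal{A}(v))=v$ for every $v\in V$. Here $w^k$ is a fixed public parameter, known to the algorithm $\mathcal{A}$, and running time is measured in the number of arithmetic operations as a function of $d$. The sign of a positive number is $1$, the sign of a negative number is $-1$, and $\mathrm{sign}(0)$ is assigned some fixed value in $\{-1,1\}$ so that $F^P$ takes values in $\{-1,1\}^d$. *)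

theory Defs
  imports
    "HOL-Probability.Probability_Mass_Function"
    "HOL-Computational_Algebra.Polynomial"
    "HOL-Library.FuncSet"
begin

section \<open>A probabilistic real RAM\<close>

text \<open>
  Points of the Euclidean spaces involved are lists of reals, because running times are functions
  of the dimension and one program has to serve all dimensions.

  Reals are stored in arrays. Array cells are addressed through index registers, which hold natural
  numbers: the operand \<open>(a, i)\<close> is the cell of array \<open>a\<close> whose position is the
  current content of index register \<open>i\<close>. There is no conversion from reals to indices and no
  multiplication of indices, and the only real constants are integers, so that exact real
  arithmetic is the only capability beyond that of an ordinary RAM.
\<close>

type_synonym operand = "nat \<times> nat"

datatype arith = Plus | Minus | Times | Divide

datatype instr =
    IConst nat nat
  | IAdd nat nat nat
  | ISub nat nat nat
  | RConst operand int
  | RArith arith operand operand operand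
  | Flip operand
  | Jump nat
  | JumpILess nat nat nat
  | JumpRLess operand operand nat

record config =
  pc :: nat
  idx :: "nat \<Rightarrow> nat"
  mem :: "nat \<Rightarrow> nat \<Rightarrow> real"

definition fetch :: "config \<Rightarrow> operand \<Rightarrow> real" where
  "fetch c x = mem c (fst x) (idx c (snd x))"

definition set_idx :: "nat \<Rightarrow> nat \<Rightarrow> config \<Rightarrow> config" where
  "set_idx i n c = c\<lparr>pc := Suc (pc c), idx := (idx c)(i := n)\<rparr>"

definition store :: "operand \<Rightarrow> real \<Rightarrow> config \<Rightarrow> config" where
  "store x r c = c\<lparr>pc := Suc (pc c),
     mem := (mem c)(fst x := (mem c (fst x))(idx c (snd x) := r))\<rparr>"

definition jump_if :: "bool \<Rightarrow> nat \<Rightarrow> config \<Rightarrow> config" where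
  "jump_if b l c = c\<lparr>pc := (if b then l else Suc (pc c))\<rparr>"

text \<open>Division by zero yields zero; subtraction of indices is truncated at zero.\<close>

fun arith_op :: "arith \<Rightarrow> real \<Rightarrow> real \<Rightarrow> real" where
  "arith_op Plus r s = r + s"
| "arith_op Minus r s = r - s"
| "arith_op Times r s = r * s"
| "arith_op Divide r s = r / s"

text \<open>The destination is the first argument, and the jump target is the last one.\<close>

fun exec :: "instr \<Rightarrow> config \<Rightarrow> config pmf" where
  "exec (IConst i n) c = return_pmf (set_idx i n c)"
| "exec (IAdd i j k) c = return_pmf (set_idx i (idx c j + idx c k) c)"
| "exec (ISub i j k) c = return_pmf (set_idx i (idx c j - idx c k) c)"
| "exec (RConst x z) c = return_pmf (store x (of_int z) c)"
| "exec (RArith f x y z) c = return_pmf (store x (arith_op f (fetch c y) (fetch c z)) c)"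
| "exec (Flip x) c = map_pmf (\<lambda>b. store x (of_bool b) c) (bernoulli_pmf (1 / 2))"
| "exec (Jump l) c = return_pmf (jump_if True l c)"
| "exec (JumpILess i j l) c = return_pmf (jump_if (idx c i < idx c j) l c)"
| "exec (JumpRLess x y l) c = return_pmf (jump_if (fetch c x < fetch c y) l c)"

type_synonym program = "instr list"

definition halted :: "program \<Rightarrow> config \<Rightarrow> bool" where
  "halted P c \<longleftrightarrow> length P \<le> pc c"

definition step :: "program \<Rightarrow> config \<Rightarrow> config pmf" where
  "step P c = (if halted P c then return_pmf c else exec (P ! pc c) c)"

fun run :: "program \<Rightarrow> nat \<Rightarrow> config \<Rightarrow> config pmf" where
  "run P 0 c = return_pmf c"
| "run P (Suc t) c = bind_pmf (step P c) (run P t)"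

text \<open>
  The public parameter \<open>w\<close> is in array 0, the input \<open>v\<close> in array 1, and the dimension in index
  register 0. The output is read from array 2, its length from index register 0.
\<close>

definition load :: "real list \<Rightarrow> nat \<Rightarrow> real" where
  "load xs j = (if j < length xs then xs ! j else 0)"

definition initial :: "nat \<Rightarrow> real list \<Rightarrow> real list \<Rightarrow> config" where
  "initial d w v = \<lparr>pc = 0, idx = (\<lambda>_. 0)(0 := d),
     mem = (\<lambda>_ _. 0)(0 := load w, 1 := load v)\<rparr>"

definition result :: "config \<Rightarrow> real list" where
  "result c = map (mem c 2) [0..<idx c 0]"

section \<open>Computational surjectivity\<close>

text \<open>
  \<open>A d w v\<close> is the output distribution of the algorithm in dimension \<open>d\<close>, with public parameter
  \<open>w\<close> and input \<open>v\<close>. Every executed instruction is counted, so the bound on the running time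
  bounds in particular the number of arithmetic operations; it holds for all outcomes of the
  coin flips. The program and the polynomial depend neither on \<open>d\<close> nor on \<open>w\<close>.
\<close>

definition ppt_algorithm ::
  "(nat \<Rightarrow> real list set) \<Rightarrow> (nat \<Rightarrow> real list set) \<Rightarrow>
   (nat \<Rightarrow> real list \<Rightarrow> real list \<Rightarrow> real list pmf) \<Rightarrow> bool" where
  "ppt_algorithm W V A \<longleftrightarrow>
     (\<exists>(P :: program) (p :: nat poly). \<forall>d\<ge>1. \<forall>w\<in>W d. \<forall>v\<in>V d.
        (\<forall>c \<in> set_pmf (run P (poly p d) (initial d w v)). halted P c) \<and>
        A d w v = map_pmf result (run P (poly p d) (initial d w v)))"

text \<open>
  \<open>f d w\<close> is a function from \<open>U d\<close> to \<open>V d\<close> for every dimension \<open>d\<close> and every public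
  parameter \<open>w\<close> in \<open>W d\<close>.
\<close>

definition computationally_surjective ::
  "(nat \<Rightarrow> real list set) \<Rightarrow> (nat \<Rightarrow> real list set) \<Rightarrow> (nat \<Rightarrow> real list set) \<Rightarrow>
   (nat \<Rightarrow> real list \<Rightarrow> real list \<Rightarrow> real list) \<Rightarrow> bool" where
  "computationally_surjective W U V f \<longleftrightarrow>
     (\<forall>d\<ge>1. \<forall>w\<in>W d. f d w \<in> U d \<rightarrow> V d) \<and>
     (\<exists>A. ppt_algorithm W V A \<and>
        (\<forall>d\<ge>1. \<forall>w\<in>W d. \<forall>v\<in>V d. \<forall>u \<in> set_pmf (A d w v). u \<in> U d \<and> f d w u = v))"

section \<open>Update preprocessing of robust stochastic aggregation\<close>

definition real_vecs :: "nat \<Rightarrow> real list set" where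
  "real_vecs d = {u. length u = d}"

definition sign_vecs :: "nat \<Rightarrow> real list set" where
  "sign_vecs d = {v. length v = d \<and> set v \<subseteq> {-1, 1}}"

text \<open>\<open>s0\<close> is the value assigned to the sign of zero.\<close>

definition sign_with :: "real \<Rightarrow> real \<Rightarrow> real" where
  "sign_with s0 x = (if x = 0 then s0 else sgn x)"

definition rsa_preprocess :: "real \<Rightarrow> real list \<Rightarrow> real list \<Rightarrow> real list" where
  "rsa_preprocess s0 w u = map2 (\<lambda>a b. sign_with s0 (a - b)) w u"

end

theory Submission
  imports Defs
begin

text \<open>
  Given \<open>v\<close>, the point \<open>u = w - v\<close> is a preimage: \<open>w - u = v\<close> has no zero coordinate, so the value
  assigned to \<open>sign 0\<close> is irrelevant and \<open>sign (w - u) = v\<close>. Computing \<open>w - v\<close> needs one pass over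
  the coordinates and no randomness.
\<close>

text \<open>Index register 1 is the loop counter and register 2 holds its increment 1, since indices
  are added only from registers. The last three instructions form a loop with its test at the
  end.\<close>

definition subtract_program :: program where
  "subtract_program =
     [IConst 2 1, RArith Minus (2, 1) (0, 1) (1, 1), IAdd 1 1 2, JumpILess 1 0 1]"

text \<open>The loop invariant: the configuration once \<open>j\<close> coordinates are done.
  Position 4 is the length of the program, so \<open>j = d\<close> means halted.\<close>

definition subtract_state :: "nat \<Rightarrow> real list \<Rightarrow> real list \<Rightarrow> nat \<Rightarrow> config" where
  "subtract_state d w v j =
     \<lparr>pc = (if j < d then 1 else 4), idx = (\<lambda>_. 0)(0 := d, 1 := j, 2 := 1),
      mem = (\<lambda>_ _. 0)(0 := load w, 1 := load v,
        2 := (\<lambda>i. if i < j then load w i - load v i else 0))\<rparr>"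

lemma run_subtract_state:
  assumes "j + k \<le> d"
  shows "run subtract_program (3 * k) (subtract_state d w v j)
    = return_pmf (subtract_state d w v (j + k))"
  using assms
proof (induction k arbitrary: j)
  case 0
  then show ?case by simp
next
  case (Suc k)
  have "run subtract_program (3 * Suc k) (subtract_state d w v j)
      = run subtract_program (Suc (Suc (Suc (3 * k)))) (subtract_state d w v j)"
    by (simp add: eval_nat_numeral)
  \<comment> \<open>One pass through the loop is three steps. The premise gives
    \<open>j < d\<close>, so control is at 1; the final jump is taken iff \<open>Suc j < d\<close>,
    as the invariant records.\<close>
  also have "\<dots> = run subtract_program (3 * k) (subtract_state d w v (Suc j))"
  proof -
    have "(\<lambda>i. if i < j then load w i - load v i else 0)(j := load w j - load v j)
        = (\<lambda>i. if i < Suc j then load w i - load v i else 0)"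
      by (auto simp: fun_eq_iff less_Suc_eq)
    then show ?thesis
      using Suc.prems
      by (simp add: subtract_state_def subtract_program_def step_def halted_def set_idx_def
          store_def fetch_def jump_if_def bind_return_pmf fun_upd_twist numeral_eq_Suc)
  qed
  finally show ?case
    using Suc.IH[of "Suc j"] Suc.prems by simp
qed

text \<open>The extra step is the initial \<open>IConst\<close>. As the body precedes the test,
  \<open>d \<ge> 1\<close> is what makes it run exactly \<open>d\<close> times.\<close>

lemma run_subtract_program:
  assumes "d \<ge> 1"
  shows "run subtract_program (Suc (3 * d)) (initial d w v) = return_pmf (subtract_state d w v d)"
proof -
  have "step subtract_program (initial d w v) = return_pmf (subtract_state d w v 0)"
    using assms
    by (auto simp: subtract_state_def subtract_program_def step_def halted_def initial_def
        set_idx_def fun_eq_iff)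
  then show ?thesis
    using run_subtract_state[of 0 d d w v] by (simp add: bind_return_pmf)
qed

lemma result_subtract_state:
  assumes "length w = d" "length v = d"
  shows "result (subtract_state d w v d) = map2 (-) w v"
  using assms by (auto simp: result_def subtract_state_def load_def intro: nth_equalityI)

lemma ppt_algorithm_subtract:
  assumes "\<And>d w. w \<in> W d \<Longrightarrow> length w = d" "\<And>d v. v \<in> V d \<Longrightarrow> length v = d"
  shows "ppt_algorithm W V (\<lambda>d w v. return_pmf (map2 (-) w v))"
proof -
  have "run subtract_program (poly [:1, 3:] d) (initial d w v)
      = return_pmf (subtract_state d w v d)" if "d \<ge> 1" for d w v
    using run_subtract_program[OF that] by (simp add: mult.commute)
  moreover have "halted subtract_program (subtract_state d w v d)" for d w v
    by (simp add: halted_def subtract_program_def subtract_state_def)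
  ultimately show ?thesis
    unfolding ppt_algorithm_def
    \<comment> \<open>The polynomial is the exact running time \<open>1 + 3 * d\<close>; it stays
      folded so that the equation for \<open>run\<close> rewrites.\<close>
    by (intro exI[of _ subtract_program] exI[of _ "[:1, 3:]"])
      (simp add: result_subtract_state assms del: poly_pCons)
qed

text \<open>The assumption on \<open>s0\<close> covers the coordinates where \<open>w\<close> and
  \<open>u\<close> agree.\<close>

lemma rsa_preprocess_in_sign_vecs:
  assumes "s0 \<in> {-1, 1}" "length w = d" "length u = d"
  shows "rsa_preprocess s0 w u \<in> sign_vecs d"
  using assms by (auto simp: sign_vecs_def rsa_preprocess_def sign_with_def sgn_if split: if_splits)

lemma rsa_preprocess_subtract:
  assumes "length w = d" "v \<in> sign_vecs d"
  shows "rsa_preprocess s0 w (map2 (-) w v) = v"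
proof (rule nth_equalityI)
  fix i assume "i < length (rsa_preprocess s0 w (map2 (-) w v))"
  then have i: "i < length w" "i < length v"
    by (auto simp: rsa_preprocess_def)
  \<comment> \<open>The sign is taken of \<open>w ! i - (w ! i - v ! i) = v ! i\<close>, which is
    nonzero and fixed by \<open>sgn\<close>.\<close>
  then have "v ! i \<in> {-1, 1}"
    using assms(2) nth_mem[of i v] unfolding sign_vecs_def by blast
  with i show "rsa_preprocess s0 w (map2 (-) w v) ! i = v ! i"
    by (auto simp: rsa_preprocess_def sign_with_def)
qed (use assms in \<open>simp add: rsa_preprocess_def sign_vecs_def\<close>)

theorem lemma1:
  fixes s0 :: real
  assumes "s0 \<in> {-1, 1}"
  shows "computationally_surjective real_vecs real_vecs sign_vecs (\<lambda>d w. rsa_preprocess s0 w)"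
  unfolding computationally_surjective_def
proof (intro conjI exI[of _ "\<lambda>d w v. return_pmf (map2 (-) w v)"])
  show "\<forall>d\<ge>1. \<forall>w\<in>real_vecs d. rsa_preprocess s0 w \<in> real_vecs d \<rightarrow> sign_vecs d"
    using assms by (auto simp: real_vecs_def intro!: rsa_preprocess_in_sign_vecs)
  show "ppt_algorithm real_vecs sign_vecs (\<lambda>d w v. return_pmf (map2 (-) w v))"
    by (rule ppt_algorithm_subtract) (auto simp: real_vecs_def sign_vecs_def)
  show "\<forall>d\<ge>1. \<forall>w\<in>real_vecs d. \<forall>v\<in>sign_vecs d.
      \<forall>u\<in>set_pmf (return_pmf (map2 (-) w v)). u \<in> real_vecs d \<and> rsa_preprocess s0 w u = v"
    by (auto simp: real_vecs_def rsa_preprocess_subtract) (simp add: sign_vecs_def)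
qed

end
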